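(* Let $P$ be a normal logic program over atoms $\mathcal{A}=\{a_1,\dots,a_n\}$, let $(\tau,\phi)\in\{0,1\}^n\times\{0,1\}^n$ and $\delta\in\{0,1\}^n$, and suppose that propagation computes the fixpoint of $\mathcal{C}_{P,\phi'}$ (i.e. the iterates of $\mathcal{C}_{P,\phi'}$ from $\tau$ reach a fixpoint $\mathcal{C}_{P,\phi'}^\infty(\tau)$, where $\phi'$ is the updated false degree). Then one update of NDProp coincides with one iteration of DProp: if $T=[\tau]$, $F=[\phi]$, $U=\mathcal{A}\setminus(T\cup F)$, and $(\tau',\phi')$ is the result of the NDProp update of $(\tau,\phi)$ with decision scores $\delta$, then $\phi'$ and $\tau'$ are the $0/1$ indicator vectors of the sets $F'$ and $T'$ obtained from $(T,F)$ by one DProp iteration whose decision step falsifies the set of atoms $U\cap[\delta]$, namely $F'=F\cup(U\cap[\delta])$ and $T'=C_{P,\mathcal{A}\setminus F'}^\infty(T)$.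
   Context: Programs. A rule $r$ of a (propositional) normal logic program has the form $a\leftarrow b_1,\dots,b_m,\mathit{not}\,c_1,\dots,\mathit{not}\,c_l$ with $m,l\ge0$ and $a,b_i,c_j\in\mathcal{A}$; $H(r)=a$, $B^+(r)=\{b_1,\dots,b_m\}$, $B^-(r)=\{c_1,\dots,c_l\}$, and the body $B(r)$ consists of the literals $b_1,\dots,b_m,\mathit{not}\,c_1,\dots,\mathit{not}\,c_l$. A program is a finite set of rules. Discrete operator and DProp iteration. For $I,J\subseteq\mathcal{A}$, $C_{P,J}(I)=\{H(r)\mid r\in P,\ B^+(r)\subseteq I,\ B^-(r)\cap J=\emptyset\}$, and $C_{P,J}^\infty(I)$ is the fixpoint reached by iterating $C_{P,J}$ from $I$. A DProp iteration takes a state $(T,F)$ with undecided set $U=\mathcal{A}\setminus(T\cup F)$, adds to $F$ a chosen set $E\subseteq U$ of atoms (decision, $F'=F\cup E$), and then sets $T'=C_{P,\mathcal{A}\setminus F'}^\infty(T)$ (propagation). NDProp update. Fix a t-norm $\otimes$ on $[0,1]$ (commutative, associative, monotone, unit $1$) and its dual t-conorm $\oplus$, $x\oplus y=1-((1-x)\otimes(1-y))$; empty $\otimes$-products equal $1$ and empty $\oplus$-sums equal $0$. For $\tau,\phi\in[0,1]^n$ put $\mathrm{val}(a_i)=\tau_i$, $\mathrm{val}(\mathit{not}\,a_i)=\phi_i$, $\rho_j(\tau,\phi)=\bigotimes_{\ell\in B(r_j)}\mathrm{val}(\ell)$ for each rule $r_j\in P$, and $(\mathcal{C}_{P,\phi}(\tau))_i=\bigoplus_{j:H(r_j)=a_i}\rho_j(\tau,\phi)$.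 Given $(\tau,\phi)$ and decision scores $\delta\in[0,1]^n$, the update is: $\mu_i=(1-\tau_i)\otimes(1-\phi_i)$, $\phi'=\phi+\mu\odot\delta$ ($\odot$ elementwise product), and $\tau'=\mathcal{C}_{P,\phi'}^\infty(\tau)$, the fixpoint reached by iterating $\mathcal{C}_{P,\phi'}$ from $\tau$. For $\psi\in[0,1]^n$, $[\psi]=\{a_i\mid\psi_i=1\}$. *)

theory Defs
  imports "HOL-Analysis.Finite_Cartesian_Product" "HOL-Library.Indicator_Function"
    "HOL-Algebra.FiniteProduct"
begin

text \<open>The atoms \<open>a\<^sub>1, \<dots>, a\<^sub>n\<close> are the elements of a finite type \<open>'n\<close>, so the set of all
  atoms is \<open>UNIV\<close> and vectors in \<open>[0,1]\<^sup>n\<close> have type \<open>real ^ 'n\<close>.\<close>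

datatype 'a rule = Rule (head: 'a) (pos_body: "'a set") (neg_body: "'a set")

datatype 'a literal = Atom 'a | Naf 'a

definition body :: "'a rule \<Rightarrow> 'a literal set" where
  "body r = Atom ` pos_body r \<union> Naf ` neg_body r"

text \<open>\<open>reaches_fixpoint f x y\<close>: the iterates of \<open>f\<close> from \<open>x\<close> become stationary at \<open>y\<close>.  There is at
  most one such \<open>y\<close>; \<open>iter_fixpoint f x\<close> is unspecified if there is none.\<close>

definition reaches_fixpoint :: "('b \<Rightarrow> 'b) \<Rightarrow> 'b \<Rightarrow> 'b \<Rightarrow> bool" where
  "reaches_fixpoint f x y \<longleftrightarrow> (\<exists>k. (f ^^ k) x = y) \<and> f y = y"

definition iter_fixpoint :: "('b \<Rightarrow> 'b) \<Rightarrow> 'b \<Rightarrow> 'b" where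
  "iter_fixpoint f x = (THE y. reaches_fixpoint f x y)"


definition C_op :: "'a rule set \<Rightarrow> 'a set \<Rightarrow> 'a set \<Rightarrow> 'a set" where
  "C_op P J I = {head r | r. r \<in> P \<and> pos_body r \<subseteq> I \<and> neg_body r \<inter> J = {}}"

definition undecided :: "'a set \<Rightarrow> 'a set \<Rightarrow> 'a set" where
  "undecided T F = UNIV - (T \<union> F)"

text \<open>The decision \<open>E\<close> is meant to be a subset of \<open>undecided T F\<close>.\<close>

definition dprop_iteration :: "'a rule set \<Rightarrow> 'a set \<Rightarrow> 'a set \<times> 'a set \<Rightarrow> 'a set \<times> 'a set" where
  "dprop_iteration P E = (\<lambda>(T, F).
     let F' = F \<union> E in (iter_fixpoint (C_op P (UNIV - F')) T, F'))"


text \<open>Values of a t-norm outside the unit interval are irrelevant.\<close>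

definition t_norm :: "(real \<Rightarrow> real \<Rightarrow> real) \<Rightarrow> bool" where
  "t_norm tn \<longleftrightarrow>
     (\<forall>x\<in>{0..1}. \<forall>y\<in>{0..1}. tn x y \<in> {0..1}) \<and>
     (\<forall>x\<in>{0..1}. \<forall>y\<in>{0..1}. tn x y = tn y x) \<and>
     (\<forall>x\<in>{0..1}. \<forall>y\<in>{0..1}. \<forall>z\<in>{0..1}. tn (tn x y) z = tn x (tn y z)) \<and>
     (\<forall>x\<in>{0..1}. \<forall>x'\<in>{0..1}. \<forall>y\<in>{0..1}. \<forall>y'\<in>{0..1}.
        x \<le> x' \<longrightarrow> y \<le> y' \<longrightarrow> tn x y \<le> tn x' y') \<and>
     (\<forall>x\<in>{0..1}. tn x 1 = x)"

definition t_conorm :: "(real \<Rightarrow> real \<Rightarrow> real) \<Rightarrow> real \<Rightarrow> real \<Rightarrow> real" where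
  "t_conorm tn x y = 1 - tn (1 - x) (1 - y)"

text \<open>Finite \<open>\<otimes>\<close>-products and \<open>\<oplus>\<close>-sums are products in the commutative monoids
  \<open>([0,1], \<otimes>, 1)\<close> and \<open>([0,1], \<oplus>, 0)\<close>.\<close>

definition tn_prod :: "(real \<Rightarrow> real \<Rightarrow> real) \<Rightarrow> ('b \<Rightarrow> real) \<Rightarrow> 'b set \<Rightarrow> real" where
  "tn_prod tn f A = finprod \<lparr>carrier = {0..1}, monoid.mult = tn, one = 1\<rparr> f A"

definition tc_sum :: "(real \<Rightarrow> real \<Rightarrow> real) \<Rightarrow> ('b \<Rightarrow> real) \<Rightarrow> 'b set \<Rightarrow> real" where
  "tc_sum tn f A = finprod \<lparr>carrier = {0..1}, monoid.mult = t_conorm tn, one = 0\<rparr> f A"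

fun val :: "real ^ 'n \<Rightarrow> real ^ 'n \<Rightarrow> 'n literal \<Rightarrow> real" where
  "val \<tau> \<phi> (Atom a) = \<tau> $ a"
| "val \<tau> \<phi> (Naf a) = \<phi> $ a"

definition rho :: "(real \<Rightarrow> real \<Rightarrow> real) \<Rightarrow> real ^ 'n \<Rightarrow> real ^ 'n \<Rightarrow> 'n rule \<Rightarrow> real" where
  "rho tn \<tau> \<phi> r = tn_prod tn (val \<tau> \<phi>) (body r)"

definition neural_C :: "(real \<Rightarrow> real \<Rightarrow> real) \<Rightarrow> 'n rule set \<Rightarrow> real ^ 'n \<Rightarrow> real ^ 'n \<Rightarrow> real ^ 'n"
  where "neural_C tn P \<phi> \<tau> = (\<chi> i. tc_sum tn (rho tn \<tau> \<phi>) {r \<in> P. head r = i})"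

definition ndprop_decide ::
    "(real \<Rightarrow> real \<Rightarrow> real) \<Rightarrow> real ^ 'n \<Rightarrow> (real ^ 'n) \<times> (real ^ 'n) \<Rightarrow> real ^ 'n" where
  "ndprop_decide tn \<delta> = (\<lambda>(\<tau>, \<phi>).
     let \<mu> = (\<chi> i. tn (1 - \<tau> $ i) (1 - \<phi> $ i)) in \<phi> + (\<chi> i. \<mu> $ i * \<delta> $ i))"

definition ndprop_update ::
    "(real \<Rightarrow> real \<Rightarrow> real) \<Rightarrow> 'n rule set \<Rightarrow> real ^ 'n \<Rightarrow> (real ^ 'n) \<times> (real ^ 'n)
       \<Rightarrow> (real ^ 'n) \<times> (real ^ 'n)" where
  "ndprop_update tn P \<delta> = (\<lambda>(\<tau>, \<phi>).
     let \<phi>' = ndprop_decide tn \<delta> (\<tau>, \<phi>) in (iter_fixpoint (neural_C tn P \<phi>') \<tau>, \<phi>'))"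

definition one_set :: "real ^ 'n \<Rightarrow> 'n set" where
  "one_set \<psi> = {a. \<psi> $ a = 1}"

definition indicator_vec :: "'n set \<Rightarrow> real ^ 'n" where
  "indicator_vec S = (\<chi> a. indicator S a)"

end

theory Submission
  imports Defs
begin

text \<open>The unit and zero laws make \<open>\<otimes>\<close> and \<open>\<oplus>\<close> act on \<open>{0,1}\<close> as conjunction and disjunction,
  whatever the t-norm.  Hence the indicator map intertwines \<open>C_op\<close> with \<open>neural_C\<close>; since it is
  injective, the two iterations become stationary together, at corresponding points.\<close>

text \<open>A fixpoint is never left again, so both points equal the iterate with index
  \<open>k + m\<close>. This is what makes the definite description in \<open>iter_fixpoint\<close>
  usable.\<close>

lemma reaches_fixpoint_unique:
  assumes "reaches_fixpoint f x y" "reaches_fixpoint f x z"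
  shows "y = z"
proof -
  obtain k m where k: "(f ^^ k) x = y" "f y = y" and m: "(f ^^ m) x = z" "f z = z"
    using assms unfolding reaches_fixpoint_def by blast
  have stationary: "(f ^^ j) w = w" if "f w = w" for j w
    using that by (induction j) auto
  have "y = (f ^^ (m + k)) x"
    using k stationary by (simp add: funpow_add)
  also have "\<dots> = (f ^^ (k + m)) x"
    by (simp add: add.commute)
  also have "\<dots> = z"
    using m stationary by (simp add: funpow_add)
  finally show ?thesis .
qed

lemma iter_fixpoint_eq:
  assumes "reaches_fixpoint f x y"
  shows "iter_fixpoint f x = y"
  unfolding iter_fixpoint_def using assms reaches_fixpoint_unique by (metis the_equality)

text \<open>The iterates correspond under \<open>h\<close> by induction. Injectivity serves the
  left-to-right direction: it cancels \<open>h\<close> in \<open>h (f z) = h z\<close>. The theorem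
  uses both directions.\<close>

lemma reaches_fixpoint_semiconjugate:
  assumes "inj h" "\<And>x. g (h x) = h (f x)"
  shows "reaches_fixpoint g (h x) y \<longleftrightarrow> (\<exists>z. y = h z \<and> reaches_fixpoint f x z)"
proof -
  have "(g ^^ k) (h x) = h ((f ^^ k) x)" for k
    by (induction k) (auto simp: assms(2))
  then show ?thesis
    unfolding reaches_fixpoint_def using assms by (auto simp: inj_eq)
qed

lemma inj_indicator_vec: "inj (indicator_vec :: 'n::finite set \<Rightarrow> _)"
proof (rule inj_on_inverseI)
  show "one_set (indicator_vec S) = S" for S :: "'n set"
    by (auto simp: one_set_def indicator_vec_def indicator_def)
qed

lemma indicator_vec_one_set:
  assumes "\<forall>i. \<psi> $ i \<in> {0, 1}"
  shows "indicator_vec (one_set \<psi>) = \<psi>"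
  using assms by (auto simp: vec_eq_iff indicator_vec_def one_set_def indicator_def)

lemma
  assumes "t_norm tn" "x \<in> {0..1}" "y \<in> {0..1}"
  shows t_norm_closed: "tn x y \<in> {0..1}"
    and t_norm_commute: "tn x y = tn y x"
    and t_norm_assoc: "z \<in> {0..1} \<Longrightarrow> tn (tn x y) z = tn x (tn y z)"
    and t_norm_mono_left: "z \<in> {0..1} \<Longrightarrow> x \<le> y \<Longrightarrow> tn x z \<le> tn y z"
  using assms unfolding t_norm_def by blast+

lemma t_norm_one:
  assumes "t_norm tn" "x \<in> {0..1}"
  shows "tn 1 x = x" "tn x 1 = x"
proof -
  show "tn x 1 = x"
    using assms unfolding t_norm_def by blast
  then show "tn 1 x = x"
    using t_norm_commute[OF assms, of 1] by simp
qed

text \<open>Annihilation follows from monotonicity and the unit: raising \<open>x\<close> to 1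
  bounds the value above by \<open>tn 1 0 = 0\<close>, and closure bounds it below by 0.\<close>

lemma t_norm_zero:
  assumes "t_norm tn" "x \<in> {0..1}"
  shows "tn 0 x = 0" "tn x 0 = 0"
proof -
  have "tn x 0 \<le> tn 1 0"
    using assms(2) by (intro t_norm_mono_left[OF assms(1)]) auto
  also have "tn 1 0 = 0"
    by (rule t_norm_one[OF assms(1)]) simp
  finally show "tn x 0 = 0"
    using t_norm_closed[OF assms, of 0] by simp
  then show "tn 0 x = 0"
    using t_norm_commute[OF assms, of 0] by simp
qed

text \<open>Provides the monoid in which \<open>finprod\<close> can be unfolded element by
  element.\<close>

lemma t_norm_comm_monoid:
  assumes "t_norm tn"
  shows "comm_monoid \<lparr>carrier = {0..1}, monoid.mult = tn, one = 1\<rparr>"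
proof (rule comm_monoidI; simp only: partial_object.simps monoid.simps)
  fix x y z :: real
  assume "x \<in> {0..1}" "y \<in> {0..1}" "z \<in> {0..1}"
  then show "tn (tn x y) z = tn x (tn y z)"
    by (rule t_norm_assoc[OF assms])
next
  fix x y :: real
  assume "x \<in> {0..1}" "y \<in> {0..1}"
  then show "tn x y \<in> {0..1}" "tn x y = tn y x"
    using t_norm_closed[OF assms] t_norm_commute[OF assms] by blast+
next
  fix x :: real
  assume "x \<in> {0..1}"
  then show "tn 1 x = x"
    by (rule t_norm_one[OF assms])
qed simp

text \<open>The complement \<open>1 - x\<close> is an involution of the unit interval that exchanges
  \<open>t_conorm tn\<close> with \<open>tn\<close> and 0 with 1, so each law is the t-norm law at
  the complements.\<close>

lemma t_conorm_comm_monoid: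
  assumes "t_norm tn"
  shows "comm_monoid \<lparr>carrier = {0..1}, monoid.mult = t_conorm tn, one = 0\<rparr>"
proof (rule comm_monoidI; simp only: partial_object.simps monoid.simps)
  fix x y z :: real
  assume "x \<in> {0..1}" "y \<in> {0..1}" "z \<in> {0..1}"
  then have compl: "1 - x \<in> {0..1}" "1 - y \<in> {0..1}" "1 - z \<in> {0..1}"
    by auto
  show "t_conorm tn (t_conorm tn x y) z = t_conorm tn x (t_conorm tn y z)"
    using t_norm_assoc[OF assms compl] by (simp add: t_conorm_def)
next
  fix x y :: real
  assume "x \<in> {0..1}" "y \<in> {0..1}"
  then have compl: "1 - x \<in> {0..1}" "1 - y \<in> {0..1}"
    by auto
  show "t_conorm tn x y \<in> {0..1}"
    using t_norm_closed[OF assms compl] by (simp add: t_conorm_def)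
  show "t_conorm tn x y = t_conorm tn y x"
    using t_norm_commute[OF assms compl] by (simp add: t_conorm_def)
next
  fix x :: real
  assume "x \<in> {0..1}"
  then show "t_conorm tn 0 x = x"
    using t_norm_one(1)[OF assms, of "1 - x"] by (simp add: t_conorm_def)
qed simp

text \<open>Writing the factors as \<open>of_bool (p a)\<close> puts them in the carrier for every
  \<open>a\<close>, as unfolding \<open>finprod\<close> requires; each new factor is then handled by
  the zero or the unit law.\<close>

lemma tn_prod_bool:
  assumes "t_norm tn" "finite A"
  shows "tn_prod tn (\<lambda>a. of_bool (p a)) A = of_bool (\<forall>a\<in>A. p a)"
proof -
  interpret comm_monoid "\<lparr>carrier = {0..1}, monoid.mult = tn, one = 1\<rparr>"
    by (rule t_norm_comm_monoid[OF assms(1)])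
  show ?thesis
    using assms(2) unfolding tn_prod_def
    by induction (auto simp: t_norm_zero[OF assms(1)] t_norm_one[OF assms(1)])
qed

lemma tc_sum_bool:
  assumes "t_norm tn" "finite A"
  shows "tc_sum tn (\<lambda>a. of_bool (p a)) A = of_bool (\<exists>a\<in>A. p a)"
proof -
  interpret comm_monoid "\<lparr>carrier = {0..1}, monoid.mult = t_conorm tn, one = 0\<rparr>"
    by (rule t_conorm_comm_monoid[OF assms(1)])
  have disj: "t_conorm tn (of_bool b) (of_bool c) = of_bool (b \<or> c)" for b c
    by (auto simp: t_conorm_def t_norm_zero[OF assms(1)] t_norm_one[OF assms(1)])
  show ?thesis
    using assms(2) unfolding tc_sum_def
  proof induction
    case (insert x B)
    then show ?case
      by (subst finprod_insert) (simp_all add: disj del: of_bool_eq_iff)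
  qed simp
qed

text \<open>The negative condition amounts to \<open>neg_body r\<close> being a subset of
  \<open>F\<close>; it is phrased with the complement to match
  \<open>C_op P (UNIV - F)\<close>.\<close>

lemma rho_indicator_vec:
  fixes S F :: "'n::finite set"
  assumes "t_norm tn"
  shows "rho tn (indicator_vec S) (indicator_vec F) r
    = of_bool (pos_body r \<subseteq> S \<and> neg_body r \<inter> (UNIV - F) = {})"
proof -
  have "val (indicator_vec S) (indicator_vec F)
      = (\<lambda>l. of_bool (case l of Atom a \<Rightarrow> a \<in> S | Naf a \<Rightarrow> a \<in> F))"
    by (auto simp: fun_eq_iff indicator_vec_def indicator_def split: literal.split)
  \<comment> \<open>Bodies are finite because there are only finitely many atoms.\<close>
  moreover have "finite (body r)"
    by (simp add: body_def)
  ultimately have "rho tn (indicator_vec S) (indicator_vec F) r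
      = of_bool (\<forall>l\<in>body r. case l of Atom a \<Rightarrow> a \<in> S | Naf a \<Rightarrow> a \<in> F)"
    using tn_prod_bool[OF assms] by (simp only: rho_def)
  also have "(\<forall>l\<in>body r. case l of Atom a \<Rightarrow> a \<in> S | Naf a \<Rightarrow> a \<in> F)
      \<longleftrightarrow> pos_body r \<subseteq> S \<and> neg_body r \<inter> (UNIV - F) = {}"
    by (auto simp: body_def ball_Un)
  finally show ?thesis .
qed

text \<open>An atom receives the disjunction of the bodies of its rules, hence 1 exactly if one of
  them fires. This is the commutation premise of
  \<open>reaches_fixpoint_semiconjugate\<close>.\<close>

lemma neural_C_indicator_vec:
  fixes S F :: "'n::finite set"
  assumes "t_norm tn" "finite P"
  shows "neural_C tn P (indicator_vec F) (indicator_vec S)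
    = indicator_vec (C_op P (UNIV - F) S)"
proof -
  have "rho tn (indicator_vec S) (indicator_vec F)
      = (\<lambda>r. of_bool (pos_body r \<subseteq> S \<and> neg_body r \<inter> (UNIV - F) = {}))"
    using rho_indicator_vec[OF assms(1)] by (rule ext)
  then show ?thesis
    unfolding neural_C_def
    using assms by (auto simp: vec_eq_iff tc_sum_bool indicator_vec_def indicator_def C_op_def)
qed

text \<open>On indicators \<mu> is 1 exactly at the undecided atoms. These lie outside
  \<open>F\<close>, so the sum stays within {0,1} and represents a union.\<close>

lemma ndprop_decide_indicator_vec:
  fixes T F D :: "'n::finite set"
  assumes "t_norm tn"
  shows "ndprop_decide tn (indicator_vec D) (indicator_vec T, indicator_vec F)
    = indicator_vec (F \<union> (undecided T F \<inter> D))"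
  by (auto simp: ndprop_decide_def Let_def vec_eq_iff indicator_vec_def indicator_def
      undecided_def t_norm_zero[OF assms] t_norm_one[OF assms])

text \<open>The \<open>reaches_fixpoint\<close> conjunct ensures that \<open>T'\<close> is a genuine
  limit of the discrete iteration, not an unspecified value of \<open>iter_fixpoint\<close>.\<close>

theorem proposition1:
  fixes tn :: "real \<Rightarrow> real \<Rightarrow> real"
    and P :: "'n::finite rule set"
    and \<tau> \<phi> \<delta> \<tau>' \<phi>' :: "real ^ 'n"
    and T F U T' F' :: "'n set"
  assumes "t_norm tn"
    and "finite P"
    and "\<forall>i. \<tau> $ i \<in> {0, 1}"
    and "\<forall>i. \<phi> $ i \<in> {0, 1}"
    and "\<forall>i. \<delta> $ i \<in> {0, 1}"
    and "\<exists>\<sigma>. reaches_fixpoint (neural_C tn P (ndprop_decide tn \<delta> (\<tau>, \<phi>))) \<tau> \<sigma>"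
    and "(\<tau>', \<phi>') = ndprop_update tn P \<delta> (\<tau>, \<phi>)"
    and "T = one_set \<tau>"
    and "F = one_set \<phi>"
    and "U = undecided T F"
    and "(T', F') = dprop_iteration P (U \<inter> one_set \<delta>) (T, F)"
  shows "F' = F \<union> (U \<inter> one_set \<delta>)
    \<and> reaches_fixpoint (C_op P (UNIV - F')) T T'
    \<and> \<phi>' = indicator_vec F'
    \<and> \<tau>' = indicator_vec T'"
proof -
  have vecs: "\<tau> = indicator_vec T" "\<phi> = indicator_vec F" "\<delta> = indicator_vec (one_set \<delta>)"
    using assms(3-5,8,9) by (simp_all add: indicator_vec_one_set)
  have F': "F' = F \<union> (U \<inter> one_set \<delta>)"
    and T': "T' = iter_fixpoint (C_op P (UNIV - F')) T"
    using assms(11) by (auto simp: dprop_iteration_def Let_def)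
  have decide: "ndprop_decide tn \<delta> (\<tau>, \<phi>) = indicator_vec F'"
    using ndprop_decide_indicator_vec[OF assms(1)] vecs F' assms(10) by metis
  then have \<phi>': "\<phi>' = indicator_vec F'"
    and \<tau>': "\<tau>' = iter_fixpoint (neural_C tn P (indicator_vec F')) (indicator_vec T)"
    using assms(7) vecs(1) by (auto simp: ndprop_update_def Let_def)
  note semiconjugate = reaches_fixpoint_semiconjugate
    [where g = "neural_C tn P (indicator_vec F')",
      OF inj_indicator_vec neural_C_indicator_vec[OF assms(1,2)]]
  \<comment> \<open>Convergence is assumed for the neural iteration; its limit is pulled back to a
    discrete limit \<open>Z\<close>. Pushing \<open>Z\<close> forward again then identifies
    \<open>\<tau>'\<close> by uniqueness.\<close>
  obtain Z where Z: "reaches_fixpoint (C_op P (UNIV - F')) T Z"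
    using assms(6) unfolding decide unfolding vecs(1) semiconjugate by blast
  then have "reaches_fixpoint (neural_C tn P (indicator_vec F')) (indicator_vec T)
      (indicator_vec Z)"
    unfolding semiconjugate by blast
  then have "\<tau>' = indicator_vec Z"
    unfolding \<tau>' by (rule iter_fixpoint_eq)
  moreover have "T' = Z"
    unfolding T' using Z by (rule iter_fixpoint_eq)
  ultimately show ?thesis
    using F' \<phi>' Z by simp
qed

end
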